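(* Let $(x^k)_{k\in\mathbb{N}}$ be the sequence generated by Method 2. Suppose that $S_*\neq\emptyset$. (i) If $\nabla f$ is globally Lipschitz continuous on $\operatorname{dom}g$, then $(f+g)(x^k)-\min_{x\in\mathcal{H}}(f+g)(x)=\mathcal{O}(k^{-1})$ as $k\to\infty$. (ii) If $\dim\mathcal{H}<+\infty$ and $\nabla f$ is locally Lipschitz continuous on $S_*$, then $(f+g)(x^k)-\min_{x\in\mathcal{H}}(f+g)(x)=o(k^{-1})$ as $k\to\infty$.
   Context: Let $\mathcal{H}$ be a real Hilbert space with inner product $\langle\cdot,\cdot\rangle$ and induced norm $\|\cdot\|$; $\overline{\mathbb{R}}:=\mathbb{R}\cup\{+\infty\}$ and $\operatorname{dom}h:=\{x\in\mathcal{H}: h(x)<+\infty\}$. Standing assumptions. (A1) $f,g:\mathcal{H}\to\overline{\mathbb{R}}$ are proper lower semicontinuous convex functions with $\operatorname{dom}g\subseteq\operatorname{dom}f$. (A2) $f$ is Fréchet differentiable on an open set containing $\operatorname{dom}g$; its gradient $\nabla f$ is uniformly continuous on any bounded subset of $\operatorname{dom}g$ and maps any bounded subset of $\operatorname{dom}g$ to a bounded set in $\mathcal{H}$. $S_*$ denotes the set of minimizers of $f+g$ over $\mathcal{H}$. "$\nabla f$ is locally Lipschitz continuous on $S_*$" means that for every $x\in S_*$ there are $\varepsilon,\mathcal{L}>0$ with $\|\nabla f(u)-\nabla f(v)\|\le\mathcal{L}\|u-v\|$ for all $u,v$ in the closed ball $\mathbb{B}_\varepsilon(x)$ of center $x$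 and radius $\varepsilon$. The proximal operator is $\operatorname{prox}_{g}:=(\mathrm{Id}+\partial g)^{-1}$, which is single-valued and defined on all of $\mathcal{H}$ with values in $\operatorname{dom}g$. Linesearch 2 $(x,\theta)$, for $x\in\operatorname{dom}g$, $\theta\in(0,1)$: set $\beta=1$ and $J_x:=\operatorname{prox}_g(x-\nabla f(x))$; while $$(f+g)(x-\beta(x-J_x))>(f+g)(x)-\beta[g(x)-g(J_x)]-\beta\langle\nabla f(x),x-J_x\rangle+\tfrac{\beta}{2}\|x-J_x\|^2,$$ replace $\beta$ by $\theta\beta$; output $\beta$. Method 2: choose $x^0\in\operatorname{dom}g$ and $\theta\in(0,1)$. For $k=0,1,2,\dots$ set $J_k=\operatorname{prox}_g(x^k-\nabla f(x^k))$ and $x^{k+1}=x^k-\beta_k(x^k-J_k)$, where $\beta_k$ is the output of Linesearch 2 $(x^k,\theta)$; the stop criterion is $x^{k+1}=x^k$. The statement concerns the infinite sequence $(x^k)_{k\in\mathbb{N}}$ so generated. *)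

theory Defs
  imports
    "HOL-Analysis.Analysis"
    "HOL-Library.Landau_Symbols"
    "HOL-Library.While_Combinator"
begin

text \<open>
  A real Hilbert space is a type of sort \<open>{real_inner, complete_space}\<close>. Functions with values in
  \<open>\<real> \<union> {+\<infinity>}\<close> are functions into \<^typ>\<open>ereal\<close>; the value \<open>-\<infinity>\<close> is excluded by \<open>proper_fun\<close>.
\<close>

definition edom :: "('a \<Rightarrow> ereal) \<Rightarrow> 'a set" where
  "edom h = {x. h x < \<infinity>}"

definition proper_fun :: "('a \<Rightarrow> ereal) \<Rightarrow> bool" where
  "proper_fun h \<longleftrightarrow> (\<forall>x. h x \<noteq> -\<infinity>) \<and> edom h \<noteq> {}"

definition lsc_fun :: "('a::topological_space \<Rightarrow> ereal) \<Rightarrow> bool" where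
  "lsc_fun h \<longleftrightarrow> (\<forall>x. h x \<le> Liminf (nhds x) h)"

definition convex_fun :: "('a::real_vector \<Rightarrow> ereal) \<Rightarrow> bool" where
  "convex_fun h \<longleftrightarrow>
    (\<forall>x y. \<forall>t\<in>{0<..<1::real}.
      h ((1 - t) *\<^sub>R x + t *\<^sub>R y) \<le> ereal (1 - t) * h x + ereal t * h y)"

text \<open>
  Differentiability and the gradient refer to the real-valued restriction of \<open>h\<close> to its domain.
  Finiteness is required on all of \<open>U\<close> because \<open>real_of_ereal \<infinity> = 0\<close>.
\<close>

definition frechet_differentiable_on :: "('a::real_inner \<Rightarrow> ereal) \<Rightarrow> 'a set \<Rightarrow> bool" where
  "frechet_differentiable_on h U \<longleftrightarrow>
    U \<subseteq> edom h \<and> (\<forall>x\<in>U. (\<lambda>y. real_of_ereal (h y)) differentiable (at x))"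

definition grad :: "('a::real_inner \<Rightarrow> ereal) \<Rightarrow> 'a \<Rightarrow> 'a" where
  "grad h x = (THE D. GDERIV (\<lambda>y. real_of_ereal (h y)) x :> D)"

definition subdifferential :: "('a::real_inner \<Rightarrow> ereal) \<Rightarrow> 'a \<Rightarrow> 'a set" where
  "subdifferential h x = {v. \<forall>y. h x + ereal (v \<bullet> (y - x)) \<le> h y}"

text \<open>The resolvent \<open>(Id + \<partial>h)\<inverse>\<close>, as a function.\<close>

definition prox :: "('a::real_inner \<Rightarrow> ereal) \<Rightarrow> 'a \<Rightarrow> 'a" where
  "prox h z = (THE p. z \<in> (\<lambda>v. p + v) ` subdifferential h p)"

definition fb_step :: "('a::real_inner \<Rightarrow> ereal) \<Rightarrow> ('a \<Rightarrow> ereal) \<Rightarrow> 'a \<Rightarrow> 'a" where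
  "fb_step f g x = prox g (x - grad f x)"

definition linesearch2 ::
    "('a::real_inner \<Rightarrow> ereal) \<Rightarrow> ('a \<Rightarrow> ereal) \<Rightarrow> 'a \<Rightarrow> real \<Rightarrow> real" where
  "linesearch2 f g x \<theta> =
    (let J = fb_step f g x in
      while
        (\<lambda>\<beta>. f (x - \<beta> *\<^sub>R (x - J)) + g (x - \<beta> *\<^sub>R (x - J)) >
              (f x + g x) - ereal \<beta> * (g x - g J) - ereal (\<beta> * (grad f x \<bullet> (x - J)))
                + ereal (\<beta> / 2 * (norm (x - J))\<^sup>2))
        (\<lambda>\<beta>. \<theta> * \<beta>)
        1)"

text \<open>
  If the stopping criterion \<open>x (Suc k) = x k\<close> is met, the sequence continues as a constant.
\<close>

definition method2 ::
    "('a::real_inner \<Rightarrow> ereal) \<Rightarrow> ('a \<Rightarrow> ereal) \<Rightarrow> real \<Rightarrow> (nat \<Rightarrow> 'a) \<Rightarrow> bool" where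
  "method2 f g \<theta> x \<longleftrightarrow>
    x 0 \<in> edom g \<and> 0 < \<theta> \<and> \<theta> < 1 \<and>
    (\<forall>k. x (Suc k) = x k - linesearch2 f g (x k) \<theta> *\<^sub>R (x k - fb_step f g (x k)))"

definition minimizers :: "('a \<Rightarrow> ereal) \<Rightarrow> 'a set" where
  "minimizers h = {x. \<forall>y. h x \<le> h y}"

text \<open>
  Shrinking \<open>\<epsilon>\<close> preserves the condition, so the values of \<open>F\<close> away from \<open>S\<close> (where a gradient
  need not exist) play no role.
\<close>

definition locally_lipschitz_at_points ::
    "'a::metric_space set \<Rightarrow> ('a \<Rightarrow> 'b::metric_space) \<Rightarrow> bool" where
  "locally_lipschitz_at_points S F \<longleftrightarrow>
    (\<forall>x\<in>S. \<exists>\<epsilon>>0. \<exists>L>0. L-lipschitz_on (cball x \<epsilon>) F)"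

end

theory Submission
  imports Defs
begin

text \<open>
  With \<open>F = f + g\<close>, the acceptance test of the linesearch and the subgradient inequality for the
  proximal step give, for every \<open>u\<close> in the domain of \<open>g\<close>,
  \<open>\<parallel>x(k+1) - u\<parallel>\<^sup>2 \<le> \<parallel>x(k) - u\<parallel>\<^sup>2 + 2 \<beta>(k) (F(u) - F(x(k))) + 2 (F(x(k)) - F(x(k+1)))\<close>.
  Taking for \<open>u\<close> a minimizer and summing, the gaps \<open>F(x(k)) - min F\<close> weighted by \<open>\<beta>(k)\<close> are summable.
  The gaps decrease, so both parts follow with rate \<open>o(1/k)\<close> once \<open>\<beta>(k)\<close> is bounded away from \<open>0\<close>.
  A rejected stepsize \<open>b\<close> forces \<open>\<nabla>f\<close> to vary by more than \<open>\<parallel>x - J\<parallel> / 2\<close> over a distance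
  \<open>b \<parallel>x - J\<parallel>\<close>, which a Lipschitz constant \<open>L\<close> excludes for \<open>b \<le> 1 / (2 L)\<close>. In the local case it
  remains to see that \<open>x\<close> converges to a minimizer. The iterates are bounded, and by the inequality
  above it suffices that some cluster point is a minimizer. That is clear if \<open>F(x(k))\<close> tends to
  \<open>min F\<close>; otherwise the \<open>\<beta>(k)\<close> are summable, so that the rejected trial points approach the
  iterates and uniform continuity of \<open>\<nabla>f\<close> yields \<open>x(k) - J(k) \<rightarrow> 0\<close>.
\<close>

section \<open>Extended-real convex functions\<close>

lemma edom_eq_ereal:
  assumes "proper_fun h" "y \<in> edom h"
  shows "h y = ereal (real_of_ereal (h y))"
  using assms unfolding proper_fun_def edom_def
  by (cases "h y") (auto simp: less_le)

lemma ereal_in_edom: "h y \<le> ereal c \<Longrightarrow> y \<in> edom h"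
  unfolding edom_def by (auto intro: le_less_trans)

lemma edom_convex_combination:
  assumes h: "proper_fun h" "convex_fun h" and y: "y \<in> edom h" and z: "z \<in> edom h"
    and t: "0 \<le> t" "t \<le> (1::real)"
  shows "(1 - t) *\<^sub>R y + t *\<^sub>R z \<in> edom h"
    and "real_of_ereal (h ((1 - t) *\<^sub>R y + t *\<^sub>R z))
      \<le> (1 - t) * real_of_ereal (h y) + t * real_of_ereal (h z)"
proof -
  let ?w = "(1 - t) *\<^sub>R y + t *\<^sub>R z"
  let ?c = "(1 - t) * real_of_ereal (h y) + t * real_of_ereal (h z)"
  have *: "h ?w \<le> ereal ?c"
  proof (cases "t = 0 \<or> t = 1")
    case True
    then show ?thesis
      using edom_eq_ereal[OF h(1) y] edom_eq_ereal[OF h(1) z] by auto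
  next
    case False
    then have "h ?w \<le> ereal (1 - t) * h y + ereal t * h z"
      using h(2) t unfolding convex_fun_def by auto
    then show ?thesis
      using edom_eq_ereal[OF h(1) y] edom_eq_ereal[OF h(1) z]
      by (metis plus_ereal.simps(1) times_ereal.simps(1))
  qed
  then show **: "?w \<in> edom h"
    by (rule ereal_in_edom)
  show "real_of_ereal (h ?w) \<le> ?c"
    using * edom_eq_ereal[OF h(1) **] by (metis ereal_less_eq(3))
qed

lemma edom_step:
  assumes h: "proper_fun h" "convex_fun h" and y: "y \<in> edom h" and z: "z \<in> edom h"
    and t: "0 \<le> t" "t \<le> (1::real)"
  shows "y - t *\<^sub>R (y - z) \<in> edom h"
    and "real_of_ereal (h (y - t *\<^sub>R (y - z)))
      \<le> (1 - t) * real_of_ereal (h y) + t * real_of_ereal (h z)"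
proof -
  have "y - t *\<^sub>R (y - z) = (1 - t) *\<^sub>R y + t *\<^sub>R z"
    by (simp add: algebra_simps)
  then show "y - t *\<^sub>R (y - z) \<in> edom h"
    "real_of_ereal (h (y - t *\<^sub>R (y - z)))
      \<le> (1 - t) * real_of_ereal (h y) + t * real_of_ereal (h z)"
    using edom_convex_combination[OF assms] by simp_all
qed

lemma lsc_fun_liminf:
  assumes "lsc_fun h" "y \<longlonglongrightarrow> p"
  shows "h p \<le> liminf (\<lambda>n. h (y n))"
  unfolding le_Liminf_iff
proof (intro allI impI)
  fix c assume "c < h p"
  with assms(1) have "eventually (\<lambda>x. c < h x) (nhds p)"
    unfolding lsc_fun_def le_Liminf_iff by blast
  with assms(2) show "\<forall>\<^sub>F n in sequentially. c < h (y n)"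
    unfolding filterlim_iff by blast
qed

lemma liminf_le_limit_bound:
  fixes u :: "nat \<Rightarrow> ereal"
  assumes "\<And>n. u n \<le> ereal (a n)" "a \<longlonglongrightarrow> l"
  shows "liminf u \<le> ereal l"
proof -
  have "liminf u \<le> liminf (\<lambda>n. ereal (a n))"
    by (rule Liminf_mono) (simp add: assms(1))
  also have "\<dots> = ereal l"
    using assms(2) by (intro lim_imp_Liminf) auto
  finally show ?thesis .
qed

lemma le_by_vanishing_term:
  fixes a b c :: real
  assumes "\<And>t. 0 < t \<Longrightarrow> t < 1 \<Longrightarrow> a \<le> b + t * c"
  shows "a \<le> b"
proof (rule tendsto_lowerbound)
  show "((\<lambda>t. b + t * c) \<longlongrightarrow> b) (at_right 0)"
    by (auto intro!: tendsto_eq_intros)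
  show "\<forall>\<^sub>F t in at_right 0. a \<le> b + t * c"
    using assms by (auto simp: eventually_at_right[of 0 "1::real"] intro!: exI[of _ 1])
qed simp

section \<open>The proximal operator and gradients in Hilbert space\<close>

text \<open>Lower semicontinuity bounds \<open>h\<close> below by \<open>h x0 - 1\<close> on a ball
  of radius \<rho> around \<open>x0\<close>. For a point farther out, the segment to
  \<open>x0\<close> meets the sphere of that ball, where this bound and convexity together give the
  slope \<open>1 / \<rho>\<close>. This does the work of an affine minorant without a separation
  theorem.\<close>

lemma lsc_convex_lower_bound:
  fixes h :: "'a::real_inner \<Rightarrow> ereal"
  assumes h: "proper_fun h" "lsc_fun h" "convex_fun h" and x0: "x0 \<in> edom h"
  obtains K where "K > 0"
    "\<And>y. y \<in> edom h \<Longrightarrow> real_of_ereal (h x0) - 1 - K * norm (y - x0) \<le> real_of_ereal (h y)"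
proof -
  let ?r = "\<lambda>y. real_of_ereal (h y)"
  have "ereal (?r x0 - 1) < h x0"
    by (subst (2) edom_eq_ereal[OF h(1) x0]) simp
  then have "eventually (\<lambda>y. ereal (?r x0 - 1) < h y) (nhds x0)"
    using h(2) unfolding lsc_fun_def le_Liminf_iff by blast
  then obtain d where d: "d > 0" "\<And>y. dist y x0 < d \<Longrightarrow> ereal (?r x0 - 1) < h y"
    unfolding eventually_nhds_metric by blast
  define \<rho> where "\<rho> = d / 2"
  have \<rho>: "\<rho> > 0" "\<rho> < d" using d(1) by (auto simp: \<rho>_def)
  have "?r x0 - 1 - (1 / \<rho>) * norm (y - x0) \<le> ?r y" if y: "y \<in> edom h" for y
  proof (cases "norm (y - x0) \<le> \<rho>")
    case True
    then have "ereal (?r x0 - 1) < h y"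
      using d(2)[of y] \<rho> by (simp add: dist_norm)
    then have "?r x0 - 1 < ?r y"
      using edom_eq_ereal[OF h(1) y] by (metis less_ereal.simps(1))
    moreover have "0 \<le> (1 / \<rho>) * norm (y - x0)" using \<rho> by simp
    ultimately show ?thesis by linarith
  next
    case False
    define n where "n = norm (y - x0)"
    define t where "t = \<rho> / n"
    have n: "n > \<rho>" using False by (simp add: n_def)
    then have t: "0 < t" "t < 1" "t * n = \<rho>" using \<rho> by (auto simp: t_def)
    let ?w = "(1 - t) *\<^sub>R x0 + t *\<^sub>R y"
    have "?w - x0 = t *\<^sub>R (y - x0)" by (simp add: algebra_simps)
    then have "dist ?w x0 < d" using t \<rho> by (simp add: dist_norm n_def)
    then have "ereal (?r x0 - 1) < h ?w" by (rule d(2))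
    moreover have w: "?w \<in> edom h" "?r ?w \<le> (1 - t) * ?r x0 + t * ?r y"
      using edom_convex_combination[OF h(1,3) x0 y] t by auto
    ultimately have "?r x0 - 1 < (1 - t) * ?r x0 + t * ?r y"
      using edom_eq_ereal[OF h(1) w(1)] by (metis less_ereal.simps(1) order_less_le_trans)
    then have "t * (?r x0 - ?r y) < 1" by (simp add: algebra_simps)
    then have "?r x0 - ?r y < 1 / t" using t(1) by (simp add: field_simps)
    also have "1 / t = (1 / \<rho>) * n" using t \<rho> n by (simp add: t_def)
    finally show ?thesis by (simp add: n_def)
  qed
  then show ?thesis using that[of "1 / \<rho>"] \<rho> by auto
qed

lemma norm_sq_midpoint:
  fixes a b z :: "'a::real_inner"
  shows "(norm ((1/2) *\<^sub>R a + (1/2) *\<^sub>R b - z))\<^sup>2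
    = (norm (a - z))\<^sup>2 / 2 + (norm (b - z))\<^sup>2 / 2 - (norm (a - b))\<^sup>2 / 4"
  unfolding power2_norm_eq_inner
  by (simp add: inner_diff inner_add inner_commute field_simps)

text \<open>The lower bound of \<open>h\<close> falls at most linearly, so the quadratic absorbs it
  by completing the square.\<close>

lemma prox_objective_bounded_below:
  fixes h :: "'a::real_inner \<Rightarrow> ereal"
  assumes h: "proper_fun h" "lsc_fun h" "convex_fun h"
  obtains M where "\<And>y. y \<in> edom h \<Longrightarrow> M \<le> real_of_ereal (h y) + (norm (y - z))\<^sup>2 / 2"
proof -
  obtain x0 where x0: "x0 \<in> edom h" using h(1) unfolding proper_fun_def by blast
  obtain K where K: "K > 0"
    "\<And>y. y \<in> edom h \<Longrightarrow> real_of_ereal (h x0) - 1 - K * norm (y - x0) \<le> real_of_ereal (h y)"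
    using lsc_convex_lower_bound[OF h x0] by blast
  show ?thesis
  proof
    fix y assume y: "y \<in> edom h"
    have "K * norm (y - x0) \<le> K * (norm (y - z) + norm (z - x0))"
      using K(1) norm_triangle_ineq[of "y - z" "z - x0"] by (intro mult_left_mono) auto
    moreover have "0 \<le> (norm (y - z) - K)\<^sup>2" by simp
    ultimately show "real_of_ereal (h x0) - 1 - K * norm (z - x0) - K\<^sup>2 / 2
        \<le> real_of_ereal (h y) + (norm (y - z))\<^sup>2 / 2"
      using K(2)[OF y] by (simp add: power2_eq_square algebra_simps)
  qed
qed

text \<open>Completeness is used once: by the parallelogram identity every minimizing sequence of
  \<open>h + \<parallel>\<cdot> - z\<parallel>\<^sup>2 / 2\<close> is Cauchy.\<close>

lemma prox_objective_minimizer: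
  fixes h :: "'a::{real_inner, complete_space} \<Rightarrow> ereal"
  assumes h: "proper_fun h" "lsc_fun h" "convex_fun h"
  obtains p where "p \<in> edom h" "\<And>y. y \<in> edom h \<Longrightarrow>
    real_of_ereal (h p) + (norm (p - z))\<^sup>2 / 2 \<le> real_of_ereal (h y) + (norm (y - z))\<^sup>2 / 2"
proof -
  let ?r = "\<lambda>y. real_of_ereal (h y)"
  define \<phi> where "\<phi> y = ?r y + (norm (y - z))\<^sup>2 / 2" for y
  obtain M where M: "\<And>y. y \<in> edom h \<Longrightarrow> M \<le> \<phi> y"
    using prox_objective_bounded_below[OF h, of z] unfolding \<phi>_def by blast
  have ne: "edom h \<noteq> {}" using h(1) unfolding proper_fun_def by blast
  define m where "m = Inf (\<phi> ` edom h)"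
  have bdd: "bdd_below (\<phi> ` edom h)" using M by (auto simp: bdd_below_def)
  have m_le: "m \<le> \<phi> y" if "y \<in> edom h" for y
    unfolding m_def using bdd that by (auto intro: cInf_lower)
  have "\<exists>y\<in>edom h. \<phi> y < m + 1 / real (Suc n)" for n
    using cInf_less_iff[of "\<phi> ` edom h" "m + 1 / real (Suc n)"] ne bdd
    unfolding m_def[symmetric] by auto
  then obtain y where y: "\<And>n. y n \<in> edom h" "\<And>n. \<phi> (y n) < m + 1 / real (Suc n)"
    by metis
  have close: "(norm (a - b))\<^sup>2 \<le> 4 * (\<phi> a - m) + 4 * (\<phi> b - m)"
    if ab: "a \<in> edom h" "b \<in> edom h" for a b
  proof -
    let ?w = "(1/2) *\<^sub>R a + (1/2) *\<^sub>R b"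
    have "?w \<in> edom h" "?r ?w \<le> ?r a / 2 + ?r b / 2"
      using edom_convex_combination[OF h(1,3) ab, of "1/2"] by auto
    then have "m \<le> ?r a / 2 + ?r b / 2 + (norm (?w - z))\<^sup>2 / 2"
      using m_le[of ?w] unfolding \<phi>_def by linarith
    then show ?thesis
      unfolding norm_sq_midpoint \<phi>_def by argo
  qed
  have "Cauchy y"
  proof (rule metric_CauchyI)
    fix e :: real assume e: "e > 0"
    \<comment> \<open>Gaps below \<open>e\<^sup>2 / 8\<close> suffice: \<open>close\<close>
      multiplies each of the two by 4.\<close>
    obtain N where N: "8 / e\<^sup>2 < real N" using reals_Archimedean2 by blast
    have "dist (y i) (y j) < e" if "N \<le> i" "N \<le> j" for i j
    proof -
      have "\<phi> (y k) - m < e\<^sup>2 / 8" if "N \<le> k" for k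
      proof -
        have "8 / e\<^sup>2 < real (Suc k)" using N that by linarith
        then have "1 / real (Suc k) < e\<^sup>2 / 8" using e by (simp add: field_simps)
        with y(2)[of k] show ?thesis by argo
      qed
      from this[OF that(1)] this[OF that(2)]
      have "(norm (y i - y j))\<^sup>2 < e\<^sup>2"
        using close[OF y(1)[of i] y(1)[of j]] by argo
      then show ?thesis
        using e power_less_imp_less_base[of "norm (y i - y j)" 2 e] by (simp add: dist_norm)
    qed
    then show "\<exists>M. \<forall>m\<ge>M. \<forall>n\<ge>M. dist (y m) (y n) < e" by blast
  qed
  then obtain p where p: "y \<longlonglongrightarrow> p"
    using Cauchy_convergent_iff[of y] convergent_def by blast
  \<comment> \<open>The quadratic is continuous and moves to the right-hand side, so that lower
    semicontinuity is applied to \<open>h\<close> alone.\<close>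
  have "(\<lambda>n. m + 1 / real (Suc n) - (norm (y n - z))\<^sup>2 / 2) \<longlonglongrightarrow> m + 0 - (norm (p - z))\<^sup>2 / 2"
    using p LIMSEQ_Suc[OF lim_1_over_n[where 'a=real]] by (intro tendsto_intros) auto
  moreover have "h (y n) \<le> ereal (m + 1 / real (Suc n) - (norm (y n - z))\<^sup>2 / 2)" for n
    using y(2)[of n] by (subst edom_eq_ereal[OF h(1) y(1)]) (simp add: \<phi>_def)
  ultimately have "liminf (\<lambda>n. h (y n)) \<le> ereal (m + 0 - (norm (p - z))\<^sup>2 / 2)"
    by (intro liminf_le_limit_bound)
  with lsc_fun_liminf[OF h(2) p] have hp: "h p \<le> ereal (m - (norm (p - z))\<^sup>2 / 2)"
    by simp
  then have pd: "p \<in> edom h" by (rule ereal_in_edom)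
  with hp have "\<phi> p \<le> m"
    unfolding \<phi>_def using edom_eq_ereal[OF h(1) pd] by (metis ereal_less_eq(3) le_diff_eq)
  then show ?thesis
    using that[OF pd] m_le unfolding \<phi>_def by fastforce
qed

lemma subdifferentialD:
  fixes h :: "'a::real_inner \<Rightarrow> ereal"
  assumes h: "proper_fun h" and v: "v \<in> subdifferential h p"
  shows "p \<in> edom h"
    and "y \<in> edom h \<Longrightarrow> real_of_ereal (h p) + v \<bullet> (y - p) \<le> real_of_ereal (h y)"
proof -
  have sub: "h p + ereal (v \<bullet> (y - p)) \<le> h y" for y
    using v unfolding subdifferential_def by blast
  obtain q where q: "q \<in> edom h" using h unfolding proper_fun_def by blast
  show pd: "p \<in> edom h"
    using sub[of q] q unfolding edom_def by auto
  show "real_of_ereal (h p) + v \<bullet> (y - p) \<le> real_of_ereal (h y)" if "y \<in> edom h"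
    using sub[of y] edom_eq_ereal[OF h pd] edom_eq_ereal[OF h that]
    by (metis ereal_less_eq(3) plus_ereal.simps(1))
qed

text \<open>The minimizer of the proximal objective works: comparing \<open>p\<close> with the point
  at fraction \<open>t\<close> of the segment to \<open>y\<close>, dividing by \<open>t\<close> and
  letting \<open>t\<close> tend to 0 leaves the subgradient inequality.\<close>

lemma resolvent_exists:
  fixes h :: "'a::{real_inner, complete_space} \<Rightarrow> ereal"
  assumes h: "proper_fun h" "lsc_fun h" "convex_fun h"
  obtains p where "z - p \<in> subdifferential h p"
proof -
  let ?r = "\<lambda>y. real_of_ereal (h y)"
  obtain p where p: "p \<in> edom h" "\<And>y. y \<in> edom h \<Longrightarrow>
    ?r p + (norm (p - z))\<^sup>2 / 2 \<le> ?r y + (norm (y - z))\<^sup>2 / 2"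
    using prox_objective_minimizer[OF h, of z] by blast
  have "h p + ereal ((z - p) \<bullet> (y - p)) \<le> h y" for y
  proof (cases "y \<in> edom h")
    case y: True
    have "?r p + (z - p) \<bullet> (y - p) \<le> ?r y"
    proof (rule le_by_vanishing_term)
      fix t :: real assume t: "0 < t" "t < 1"
      let ?w = "(1 - t) *\<^sub>R p + t *\<^sub>R y"
      have w: "?w \<in> edom h" "?r ?w \<le> (1 - t) * ?r p + t * ?r y"
        using edom_convex_combination[OF h(1,3) p(1) y] t by auto
      have eq: "?w - z = (p - z) + t *\<^sub>R (y - p)" by (simp add: algebra_simps)
      have "(norm (?w - z))\<^sup>2
          = (norm (p - z))\<^sup>2 - 2 * t * ((z - p) \<bullet> (y - p)) + t\<^sup>2 * (norm (y - p))\<^sup>2"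
        unfolding eq power2_norm_eq_inner
        by (simp add: inner_diff inner_add inner_commute power2_eq_square algebra_simps)
      with p(2)[OF w(1)] w(2)
      have "t * (?r p + (z - p) \<bullet> (y - p)) \<le> t * (?r y + t * ((norm (y - p))\<^sup>2 / 2))"
        by (simp add: algebra_simps power2_eq_square)
      then show "?r p + (z - p) \<bullet> (y - p) \<le> ?r y + t * ((norm (y - p))\<^sup>2 / 2)"
        using t by simp
    qed
    then show ?thesis
      using edom_eq_ereal[OF h(1) p(1)] edom_eq_ereal[OF h(1) y]
      by (metis ereal_less_eq(3) plus_ereal.simps(1))
  next
    case False
    then show ?thesis by (simp add: edom_def)
  qed
  then show ?thesis using that[of p] unfolding subdifferential_def by blast
qed

text \<open>Adding the two subgradient inequalities, each tested at the other point, gives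
  monotonicity; Cauchy-Schwarz does the rest.\<close>

lemma resolvent_nonexpansive:
  fixes h :: "'a::real_inner \<Rightarrow> ereal"
  assumes h: "proper_fun h"
    and p: "z - p \<in> subdifferential h p" and q: "w - q \<in> subdifferential h q"
  shows "norm (p - q) \<le> norm (z - w)"
proof -
  have "(z - p) \<bullet> (q - p) + (w - q) \<bullet> (p - q) \<le> 0"
    using subdifferentialD(2)[OF h p subdifferentialD(1)[OF h q]]
      subdifferentialD(2)[OF h q subdifferentialD(1)[OF h p]] by linarith
  then have "(norm (p - q))\<^sup>2 \<le> (z - w) \<bullet> (p - q)"
    unfolding power2_norm_eq_inner by (simp add: inner_diff inner_commute algebra_simps)
  also have "\<dots> \<le> norm (z - w) * norm (p - q)"
    by (rule norm_cauchy_schwarz)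
  finally have "norm (p - q) * norm (p - q) \<le> norm (z - w) * norm (p - q)"
    by (simp add: power2_eq_square)
  then show ?thesis
    by (cases "p = q") auto
qed

text \<open>This makes the definite description in \<open>prox\<close> usable: existence is
  \<open>resolvent_exists\<close>, uniqueness is nonexpansiveness with equal arguments.\<close>

lemma prox_subdifferential:
  fixes h :: "'a::{real_inner, complete_space} \<Rightarrow> ereal"
  assumes h: "proper_fun h" "lsc_fun h" "convex_fun h"
  shows "z - prox h z \<in> subdifferential h (prox h z)"
proof -
  have eq: "z \<in> (\<lambda>v. p + v) ` subdifferential h p \<longleftrightarrow> z - p \<in> subdifferential h p" for p
    by (force simp: image_iff)
  obtain p where p: "z - p \<in> subdifferential h p" using resolvent_exists[OF h] .
  have "q = p" if "z - q \<in> subdifferential h q" for q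
    using resolvent_nonexpansive[OF h(1) that p] by simp
  with p have "\<exists>!p. z - p \<in> subdifferential h p" by blast
  then show ?thesis unfolding prox_def eq by (rule theI')
qed

section \<open>Riesz representation and gradients\<close>

text \<open>The functional \<open>D\<close> is represented by the point at which
  \<open>\<parallel>\<cdot>\<parallel>\<^sup>2 / 2 - D\<close> is minimal, that is, by the resolvent of \<open>-D\<close> at \<open>0\<close>.\<close>

lemma riesz_representation:
  fixes D :: "'a::{real_inner, complete_space} \<Rightarrow> real"
  assumes D: "bounded_linear D"
  obtains v where "\<And>y. D y = y \<bullet> v"
proof -
  interpret D: bounded_linear D by (rule D)
  define h where "h y = ereal (- D y)" for y
  have dom: "edom h = UNIV" by (auto simp: edom_def h_def)
  have proper: "proper_fun h" by (auto simp: proper_fun_def dom h_def)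
  have "Liminf (nhds x) h = h x" for x
  proof -
    have "isCont D x" by (simp add: D.isCont)
    then show ?thesis
      unfolding h_def
      by (intro lim_imp_Liminf) (auto intro!: tendsto_intros simp: isCont_def tendsto_nhds_iff)
  qed
  then have lsc: "lsc_fun h" by (simp add: lsc_fun_def)
  have conv: "convex_fun h"
    by (auto simp: convex_fun_def h_def D.add D.diff D.scaleR algebra_simps)
  obtain p where p: "0 - p \<in> subdifferential h p"
    using resolvent_exists[OF proper lsc conv] .
  have le: "D y \<le> p \<bullet> y" for y
  proof -
    have "- D p + (0 - p) \<bullet> ((p + y) - p) \<le> - D (p + y)"
      using subdifferentialD(2)[OF proper p, of "p + y"] by (simp add: dom h_def)
    then show ?thesis by (simp add: D.add)
  qed
  have "D y = y \<bullet> p" for y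
    using le[of y] le[of "- y"] by (simp add: linear_neg[OF D.linear] inner_commute)
  then show ?thesis using that by blast
qed

text \<open>The description in \<open>grad\<close> denotes: the derivative has a Riesz vector, and
  two such vectors \<open>v\<close>, \<open>w\<close> agree because their functionals coincide at
  \<open>w - v\<close>.\<close>

lemma has_derivative_grad:
  fixes h :: "'a::{real_inner, complete_space} \<Rightarrow> ereal"
  assumes "(\<lambda>y. real_of_ereal (h y)) differentiable (at x)"
  shows "((\<lambda>y. real_of_ereal (h y)) has_derivative (\<lambda>v. v \<bullet> grad h x)) (at x)"
proof -
  obtain D where D: "((\<lambda>y. real_of_ereal (h y)) has_derivative D) (at x)"
    using assms unfolding differentiable_def by blast
  obtain v where "\<And>y. D y = y \<bullet> v"
    using riesz_representation[OF has_derivative_bounded_linear[OF D]] by blast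
  then have "D = (\<lambda>y. y \<bullet> v)" by blast
  with D have v: "GDERIV (\<lambda>y. real_of_ereal (h y)) x :> v" by (simp add: gderiv_def)
  have "w = v" if "GDERIV (\<lambda>y. real_of_ereal (h y)) x :> w" for w
  proof -
    have "(\<lambda>y. y \<bullet> w) = (\<lambda>y. y \<bullet> v)"
      using has_derivative_unique that v unfolding gderiv_def by blast
    then have "(w - v) \<bullet> w = (w - v) \<bullet> v" by metis
    then show "w = v" by (metis inner_diff_right inner_eq_zero_iff right_minus_eq)
  qed
  with v have "\<exists>!D. GDERIV (\<lambda>y. real_of_ereal (h y)) x :> D" by blast
  then have "GDERIV (\<lambda>y. real_of_ereal (h y)) x :> grad h x"
    unfolding grad_def by (rule theI')
  then show ?thesis by (simp add: gderiv_def)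
qed

lemma has_derivative_along_ray:
  fixes r :: "'a::real_inner \<Rightarrow> real"
  assumes "(r has_derivative (\<lambda>v. v \<bullet> G)) (at x)" "e > 0"
  obtains d where "d > 0"
    "\<And>t. 0 < t \<Longrightarrow> t < d \<Longrightarrow> \<bar>r (x + t *\<^sub>R v) - r x - t * (v \<bullet> G)\<bar> \<le> e * t"
proof -
  \<comment> \<open>The added 1 keeps the divisor positive when \<open>v = 0\<close>.\<close>
  define e' where "e' = e / (norm v + 1)"
  have pos: "norm v + 1 > 0" by (simp add: add_nonneg_pos)
  have e': "e' > 0" using assms(2) pos by (simp add: e'_def)
  then obtain d where d: "d > 0" "\<And>y. norm (y - x) < d \<Longrightarrow>
      norm (r y - r x - (y - x) \<bullet> G) \<le> e' * norm (y - x)"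
    using assms(1) unfolding has_derivative_at_alt by blast
  show ?thesis
  proof (rule that)
    show "d / (norm v + 1) > 0" using d(1) pos by simp
    fix t assume t: "0 < t" "t < d / (norm v + 1)"
    have "t * norm v < t * (norm v + 1)" using t(1) by simp
    also have "\<dots> < d" using t(2) pos by (simp add: field_simps)
    finally have "norm (x + t *\<^sub>R v - x) < d" using t(1) by simp
    from d(2)[OF this]
    have "\<bar>r (x + t *\<^sub>R v) - r x - t * (v \<bullet> G)\<bar> \<le> e' * (t * norm v)"
      using t(1) by simp
    also have "\<dots> \<le> e' * (t * (norm v + 1))"
      using t(1) e' by (intro mult_left_mono) auto
    also have "\<dots> = e * t" using pos by (simp add: e'_def)
    finally show "\<bar>r (x + t *\<^sub>R v) - r x - t * (v \<bullet> G)\<bar> \<le> e * t" .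
  qed
qed

text \<open>Convexity bounds the increment over a short step toward \<open>x\<close> by
  \<open>t\<close> times the total increment; differentiability compares it with the linear term up
  to \<open>e * t\<close>. Dividing by \<open>t\<close> leaves an arbitrary error
  \<open>e\<close>.\<close>

lemma gradient_inequality:
  fixes h :: "'a::{real_inner, complete_space} \<Rightarrow> ereal"
  assumes h: "proper_fun h" "convex_fun h" and x: "x \<in> edom h" and y: "y \<in> edom h"
    and diff: "(\<lambda>y. real_of_ereal (h y)) differentiable (at y)"
  shows "real_of_ereal (h y) + grad h y \<bullet> (x - y) \<le> real_of_ereal (h x)"
proof (rule field_le_epsilon)
  let ?r = "\<lambda>y. real_of_ereal (h y)"
  fix e :: real assume "e > 0"
  then obtain d where d: "d > 0" "\<And>t. 0 < t \<Longrightarrow> t < d \<Longrightarrow>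
      \<bar>?r (y + t *\<^sub>R (x - y)) - ?r y - t * ((x - y) \<bullet> grad h y)\<bar> \<le> e * t"
    using has_derivative_along_ray[OF has_derivative_grad[OF diff], of e "x - y"] by blast
  define t where "t = min (d / 2) 1"
  have t: "0 < t" "t < d" "t \<le> 1" using d(1) by (auto simp: t_def)
  have "y + t *\<^sub>R (x - y) = (1 - t) *\<^sub>R y + t *\<^sub>R x" by (simp add: algebra_simps)
  then have "?r (y + t *\<^sub>R (x - y)) \<le> (1 - t) * ?r y + t * ?r x"
    using edom_convex_combination(2)[OF h y x, of t] t by simp
  with d(2)[OF t(1,2)] have "t * (?r y + grad h y \<bullet> (x - y)) \<le> t * (?r x + e)"
    by (simp add: algebra_simps inner_commute abs_le_iff)
  then show "?r y + grad h y \<bullet> (x - y) \<le> ?r x + e"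
    using t(1) by simp
qed

section \<open>Compactness and rates for sequences\<close>

text \<open>By induction, each new index contributes a compact Minkowski summand. With segments for
  \<open>K c\<close> this is compactness of a box of coordinates.\<close>

lemma compact_sum_set:
  fixes K :: "'i \<Rightarrow> 'b::real_normed_vector set"
  assumes "finite C" "\<And>c. c \<in> C \<Longrightarrow> compact (K c)"
  shows "compact {sum p C |p. \<forall>c\<in>C. p c \<in> K c}"
  using assms
proof (induction C)
  case empty
  then show ?case by simp
next
  case (insert a C)
  let ?S = "{sum p C |p. \<forall>c\<in>C. p c \<in> K c}"
  have "{sum p (insert a C) |p. \<forall>c\<in>insert a C. p c \<in> K c} = {y + z |y z. y \<in> K a \<and> z \<in> ?S}"
    (is "?L = ?R")
  proof (intro equalityI subsetI)
    fix w assume "w \<in> ?L"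
    then show "w \<in> ?R" using insert.hyps by auto
  next
    fix w assume "w \<in> ?R"
    then obtain y p where yp: "w = y + sum p C" "y \<in> K a" "\<forall>c\<in>C. p c \<in> K c" by blast
    have "sum (p(a := y)) C = sum p C"
      using insert.hyps by (intro sum.cong) auto
    then have "w = sum (p(a := y)) (insert a C)" using insert.hyps yp by simp
    moreover have "\<forall>c\<in>insert a C. (p(a := y)) c \<in> K c" using yp by simp
    ultimately show "w \<in> ?L" by blast
  qed
  moreover have "compact ?R" using insert by (intro compact_sums) auto
  ultimately show ?case by simp
qed

text \<open>The library's compactness of closed balls is stated for class \<open>heine_borel\<close>, which a type with
  a finite spanning set as an explicit hypothesis does not have.\<close>

lemma finite_span_convergent_subsequence:
  fixes x :: "nat \<Rightarrow> 'a::real_inner" and B :: "'a set"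
  assumes B: "finite B" "span B = UNIV" and x: "bounded (range x)"
  obtains l r where "strict_mono r" "(\<lambda>n. x (r n)) \<longlonglongrightarrow> l"
proof -
  obtain C where C: "finite C" "span C = (UNIV::'a set)" "pairwise orthogonal C"
    using basis_orthogonal[OF B(1)] B(2) by metis
  obtain R where R: "\<And>n. norm (x n) \<le> R"
    using x by (auto simp: bounded_iff)
  \<comment> \<open>By orthogonality the coefficient along \<open>c\<close> is at most
    \<open>R / norm c\<close> in absolute value. For \<open>c = 0\<close> division by zero yields 0,
    and \<open>K c\<close> is the singleton of 0.\<close>
  define K where "K c = (\<lambda>t. t *\<^sub>R c) ` {- R / norm c..R / norm c}" for c :: 'a
  have "compact (K c)" for c
    unfolding K_def by (intro compact_continuous_image continuous_intros) auto
  then have comp: "compact {sum p C |p. \<forall>c\<in>C. p c \<in> K c}"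
    using C(1) by (intro compact_sum_set)
  have mem: "x n \<in> {sum p C |p. \<forall>c\<in>C. p c \<in> K c}" for n
  proof -
    have "x n \<in> range (\<lambda>u. \<Sum>c\<in>C. u c *\<^sub>R c)"
      using C(2) span_finite[OF C(1)] by simp
    then obtain u where u: "x n = (\<Sum>c\<in>C. u c *\<^sub>R c)" by blast
    have uc: "u c *\<^sub>R c \<in> K c" if c: "c \<in> C" for c
    proof (cases "c = 0")
      case True
      then show ?thesis unfolding K_def by (intro image_eqI[of _ _ 0]) auto
    next
      case False
      have "x n \<bullet> c = (\<Sum>b\<in>C. u b * (b \<bullet> c))" by (simp add: u inner_sum_left)
      also have "\<dots> = u c * (c \<bullet> c)"
        using C(1,3) c by (subst sum.remove[of C c]) (auto simp: pairwise_def orthogonal_def)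
      finally have "\<bar>u c\<bar> * (norm c)\<^sup>2 = \<bar>x n \<bullet> c\<bar>"
        by (simp add: abs_mult power2_norm_eq_inner)
      also have "\<dots> \<le> norm (x n) * norm c" by (rule Cauchy_Schwarz_ineq2)
      also have "\<dots> \<le> R * norm c" using R by (intro mult_right_mono) auto
      finally have "\<bar>u c\<bar> \<le> R / norm c"
        using False by (simp add: power2_eq_square field_simps)
      then show ?thesis unfolding K_def by (intro image_eqI[of _ _ "u c"]) (auto simp: abs_le_iff)
    qed
    then show ?thesis using u by blast
  qed
  then obtain l r where "strict_mono r" "(x \<circ> r) \<longlonglongrightarrow> l"
    using seq_compactE[OF compact_imp_seq_compact[OF comp], of x] by blast
  then show ?thesis using that by (simp add: o_def)
qed

text \<open>At least \<open>k / 2\<close> indices lie between \<open>k div 2\<close> and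
  \<open>k - 1\<close>, and each of their terms is at least \<open>a k\<close>. So
  \<open>k * a k\<close> is at most twice their sum, which tends to 0 as a difference of partial
  sums.\<close>

lemma decseq_summable_smallo:
  fixes a :: "nat \<Rightarrow> real"
  assumes a: "decseq a" "\<And>n. 0 \<le> a n" "summable a"
  shows "a \<in> o(\<lambda>k. 1 / real k)"
proof -
  define S where "S n = (\<Sum>i<n. a i)" for n
  have S: "S \<longlonglongrightarrow> suminf a"
    unfolding S_def using summable_LIMSEQ[OF a(3)] .
  have "filterlim (\<lambda>k::nat. k div 2) sequentially sequentially"
    unfolding filterlim_at_top
  proof
    fix Z :: nat
    show "\<forall>\<^sub>F k in sequentially. Z \<le> k div 2"
      using eventually_ge_at_top[of "2 * Z"] by eventually_elim auto
  qed
  then have "(\<lambda>k. S (k div 2)) \<longlonglongrightarrow> suminf a"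
    by (rule filterlim_compose[OF S])
  then have "(\<lambda>k. 2 * (S k - S (k div 2))) \<longlonglongrightarrow> 2 * (suminf a - suminf a)"
    by (intro tendsto_intros S)
  then have lim: "(\<lambda>k. 2 * (S k - S (k div 2))) \<longlonglongrightarrow> 0" by simp
  have bound: "real k * a k \<le> 2 * (S k - S (k div 2))" for k
  proof -
    have "S k - S (k div 2) = (\<Sum>i\<in>{k div 2..<k}. a i)"
      unfolding S_def lessThan_atLeast0 by (subst sum_diff_nat_ivl) auto
    moreover have "(\<Sum>i\<in>{k div 2..<k}. a k) \<le> (\<Sum>i\<in>{k div 2..<k}. a i)"
      using a(1) by (intro sum_mono) (auto simp: decseq_def)
    ultimately have "real (k - k div 2) * a k \<le> S k - S (k div 2)" by simp
    moreover have "real k / 2 * a k \<le> real (k - k div 2) * a k"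
      using a(2) by (intro mult_right_mono) linarith+
    ultimately show ?thesis by simp
  qed
  have "(\<lambda>k. real k * a k) \<longlonglongrightarrow> 0"
    using bound a(2) by (intro tendsto_sandwich[OF _ _ tendsto_const lim]) auto
  then have "(\<lambda>k. a k / (1 / real k)) \<longlonglongrightarrow> 0" by (simp add: mult.commute)
  then show ?thesis
    by (rule smalloI_tendsto) (auto intro: eventually_mono[OF eventually_gt_at_top[of 0]])
qed

section \<open>The linesearch\<close>

text \<open>Unfolding \<open>while\<close> gives the least exponent at which the test fails; the
  given \<open>n\<close> shows that there is one, and leastness records that every earlier trial was
  rejected.\<close>

lemma while_geometric:
  fixes \<theta> :: real
  assumes "\<not> b (\<theta> ^ n)"
  obtains N where "while b (\<lambda>\<beta>. \<theta> * \<beta>) 1 = \<theta> ^ N" "\<not> b (\<theta> ^ N)" "\<And>m. m < N \<Longrightarrow> b (\<theta> ^ m)"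
proof -
  have pow: "((\<lambda>\<beta>. \<theta> * \<beta>) ^^ k) 1 = \<theta> ^ k" for k by (induction k) auto
  show ?thesis
  proof
    show "while b (\<lambda>\<beta>. \<theta> * \<beta>) 1 = \<theta> ^ (LEAST k. \<not> b (\<theta> ^ k))"
      unfolding while_def while_option_def pow using assms by auto
    show "\<not> b (\<theta> ^ (LEAST k. \<not> b (\<theta> ^ k)))" by (rule LeastI[of _ n]) (rule assms)
    show "b (\<theta> ^ m)" if "m < (LEAST k. \<not> b (\<theta> ^ k))" for m
      using not_less_Least[OF that] by blast
  qed
qed

locale composite_problem =
  fixes f g :: "'a::{real_inner, complete_space} \<Rightarrow> ereal"
  assumes f: "proper_fun f" "lsc_fun f" "convex_fun f"
    and g: "proper_fun g" "lsc_fun g" "convex_fun g"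
    and dom: "edom g \<subseteq> edom f"
    and diff: "y \<in> edom g \<Longrightarrow> (\<lambda>y. real_of_ereal (f y)) differentiable (at y)"
begin

abbreviation "fr y \<equiv> real_of_ereal (f y)"
abbreviation "gr y \<equiv> real_of_ereal (g y)"
abbreviation "G \<equiv> grad f"
abbreviation "J y \<equiv> fb_step f g y"

definition F :: "'a \<Rightarrow> real" where "F y = fr y + gr y"
definition res :: "'a \<Rightarrow> 'a" where "res y = y - J y"

text \<open>The negated loop test in real arithmetic. The two agree for \<open>y\<close> in
  \<open>edom g\<close> and \<open>b\<close> in [0,1], where all values involved are finite.\<close>

definition armijo :: "'a \<Rightarrow> real \<Rightarrow> bool" where
  "armijo y b \<longleftrightarrow> F (y - b *\<^sub>R res y)
    \<le> F y - b * (gr y - gr (J y)) - b * (G y \<bullet> res y) + b / 2 * (norm (res y))\<^sup>2"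

lemma sum_eq_F: "y \<in> edom g \<Longrightarrow> f y + g y = ereal (F y)"
  using edom_eq_ereal[OF f(1)] edom_eq_ereal[OF g(1)] dom unfolding F_def
  by (metis plus_ereal.simps(1) subsetD)

lemma sum_le_ereal_in_edom: "f y + g y \<le> ereal c \<Longrightarrow> y \<in> edom g"
  using f(1) unfolding edom_def proper_fun_def by (cases "f y"; cases "g y") auto

lemma fb_step_subdifferential: "res y - G y \<in> subdifferential g (J y)"
  using prox_subdifferential[OF g, of "y - G y"]
  unfolding res_def fb_step_def by (simp add: algebra_simps)

lemma J_edom: "J y \<in> edom g"
  by (rule subdifferentialD(1)[OF g(1) fb_step_subdifferential])

lemma fb_step_inequality: "u \<in> edom g \<Longrightarrow> gr (J y) + (res y - G y) \<bullet> (u - J y) \<le> gr u"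
  by (rule subdifferentialD(2)[OF g(1) fb_step_subdifferential])

lemma f_gradient_inequality: "y \<in> edom g \<Longrightarrow> u \<in> edom g \<Longrightarrow> fr y + G y \<bullet> (u - y) \<le> fr u"
  using gradient_inequality[OF f(1,3)] dom diff by blast

lemma step_edom:
  assumes "y \<in> edom g" "0 \<le> b" "b \<le> 1"
  shows "y - b *\<^sub>R res y \<in> edom g"
    and "gr (y - b *\<^sub>R res y) \<le> (1 - b) * gr y + b * gr (J y)"
  using edom_step[OF g(1,3) assms(1) J_edom assms(2,3)] unfolding res_def by auto

text \<open>This gives termination of the linesearch. Convexity bounds the change of
  \<open>g\<close>, and for small \<open>b\<close> the first-order error of \<open>f\<close> along
  \<open>- res y\<close> fits into the slack \<open>b / 2 * (norm (res y))\<^sup>2\<close> of the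
  test.\<close>

lemma armijo_small:
  assumes y: "y \<in> edom g"
  obtains e where "e > 0" "\<And>b. 0 < b \<Longrightarrow> b < e \<Longrightarrow> b \<le> 1 \<Longrightarrow> armijo y b"
proof (cases "res y = 0")
  case True
  then have "armijo y b" for b unfolding armijo_def res_def by simp
  then show ?thesis using that[of 1] by simp
next
  case False
  let ?e = "(norm (res y))\<^sup>2 / 2"
  have "?e > 0" using False by simp
  then obtain d where d: "d > 0" "\<And>t. 0 < t \<Longrightarrow> t < d \<Longrightarrow>
      \<bar>fr (y + t *\<^sub>R (- res y)) - fr y - t * ((- res y) \<bullet> G y)\<bar> \<le> ?e * t"
    using has_derivative_along_ray[OF has_derivative_grad[OF diff[OF y]]] by blast
  have "armijo y b" if b: "0 < b" "b < d" "b \<le> 1" for b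
  proof -
    have "fr (y - b *\<^sub>R res y) - fr y + b * (G y \<bullet> res y) \<le> ?e * b"
      using abs_le_D1[OF d(2)[OF b(1,2)]] by (simp add: inner_commute)
    then show ?thesis
      using step_edom(2)[OF y, of b] b unfolding armijo_def F_def
      by (simp add: algebra_simps)
  qed
  then show ?thesis using that d(1) by blast
qed

text \<open>By convexity of \<open>g\<close> along the step, a rejected stepsize is the fault of \<open>f\<close> alone.\<close>

lemma not_armijo_gradient_gap:
  assumes y: "y \<in> edom g" and b: "0 < b" "b \<le> 1" and rej: "\<not> armijo y b"
  shows "norm (res y) / 2 < norm (G y - G (y - b *\<^sub>R res y))"
proof -
  let ?d = "res y" and ?w = "y - b *\<^sub>R res y"
  have w: "?w \<in> edom g" "gr ?w \<le> (1 - b) * gr y + b * gr (J y)"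
    using step_edom[OF y] b by auto
  have "fr ?w + G ?w \<bullet> (y - ?w) \<le> fr y"
    by (rule f_gradient_inequality[OF w(1) y])
  then have "fr ?w + b * (G ?w \<bullet> ?d) \<le> fr y" by simp
  with rej w(2) have "b * ((norm ?d)\<^sup>2 / 2) < b * ((G y - G ?w) \<bullet> ?d)"
    unfolding armijo_def F_def by (simp add: algebra_simps inner_diff_left)
  then have "(norm ?d)\<^sup>2 / 2 < (G y - G ?w) \<bullet> ?d" using b by simp
  also have "\<dots> \<le> norm (G y - G ?w) * norm ?d" by (rule norm_cauchy_schwarz)
  finally have *: "norm ?d * (norm ?d / 2) < norm ?d * norm (G y - G ?w)"
    by (simp add: power2_eq_square mult.commute)
  then have "norm ?d \<noteq> 0" by auto
  then have "norm ?d > 0" by simp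
  with * show ?thesis using mult_less_cancel_left_pos by blast
qed

text \<open>The last conclusion retains the previous trial \<open>\<beta> / \<theta>\<close>: its
  rejection is what later bounds the stepsize from below.\<close>

lemma linesearch2_output:
  assumes y: "y \<in> edom g" and \<theta>: "0 < \<theta>" "\<theta> < 1"
  defines "\<beta> \<equiv> linesearch2 f g y \<theta>"
  shows "0 < \<beta>" "\<beta> \<le> 1" "armijo y \<beta>"
    and "\<beta> = 1 \<or> \<beta> / \<theta> \<le> 1 \<and> \<not> armijo y (\<beta> / \<theta>)"
proof -
  let ?b = "\<lambda>\<beta>. f (y - \<beta> *\<^sub>R (y - J y)) + g (y - \<beta> *\<^sub>R (y - J y)) >
              (f y + g y) - ereal \<beta> * (g y - g (J y)) - ereal (\<beta> * (G y \<bullet> (y - J y)))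
                + ereal (\<beta> / 2 * (norm (y - J y))\<^sup>2)"
  have b_iff: "?b b \<longleftrightarrow> \<not> armijo y b" if b: "0 \<le> b" "b \<le> 1" for b
  proof -
    have "f (y - b *\<^sub>R (y - J y)) + g (y - b *\<^sub>R (y - J y)) = ereal (F (y - b *\<^sub>R res y))"
      using sum_eq_F[OF step_edom(1)[OF y b]] by (simp add: res_def)
    moreover have "g y - g (J y) = ereal (gr y - gr (J y))"
      using edom_eq_ereal[OF g(1) y] edom_eq_ereal[OF g(1) J_edom] by (metis ereal_minus(1))
    ultimately show ?thesis
      using sum_eq_F[OF y] unfolding armijo_def res_def by (simp add: not_le)
  qed
  have pow: "0 < \<theta> ^ k" "\<theta> ^ k \<le> 1" for k
    using \<theta> by (auto intro: power_le_one)
  obtain e where e: "e > 0" "\<And>b. 0 < b \<Longrightarrow> b < e \<Longrightarrow> b \<le> 1 \<Longrightarrow> armijo y b"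
    using armijo_small[OF y] by blast
  obtain n where "\<theta> ^ n < e"
    using real_arch_pow_inv[OF e(1) \<theta>(2)] by blast
  then have "\<not> ?b (\<theta> ^ n)" using b_iff[of "\<theta> ^ n"] pow e(2) by (simp add: less_imp_le)
  then obtain N where N: "while ?b (\<lambda>\<beta>. \<theta> * \<beta>) 1 = \<theta> ^ N" "\<not> ?b (\<theta> ^ N)"
    "\<And>m. m < N \<Longrightarrow> ?b (\<theta> ^ m)"
    using while_geometric[of ?b \<theta> n] by blast
  have \<beta>: "\<beta> = \<theta> ^ N" unfolding \<beta>_def linesearch2_def Let_def using N(1) .
  show "0 < \<beta>" "\<beta> \<le> 1" using pow \<beta> by auto
  show "armijo y \<beta>" using N(2) b_iff[of "\<theta> ^ N"] pow \<beta> by (simp add: less_imp_le)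
  show "\<beta> = 1 \<or> \<beta> / \<theta> \<le> 1 \<and> \<not> armijo y (\<beta> / \<theta>)"
  proof (cases N)
    case 0
    then show ?thesis by (simp add: \<beta>)
  next
    case (Suc m)
    then have "\<beta> / \<theta> = \<theta> ^ m" using \<theta> \<beta> by simp
    then show ?thesis using N(3)[of m] b_iff[of "\<theta> ^ m"] pow Suc by (simp add: less_imp_le)
  qed
qed

text \<open>Testing the proximal inequality at \<open>y\<close> itself bounds the linearized
  decrease below by \<open>(norm (res y))\<^sup>2\<close>, and the quadratic term of the test gives
  back only half of that.\<close>

lemma armijo_descent:
  assumes y: "y \<in> edom g" and b: "0 \<le> b" and acc: "armijo y b"
  shows "F (y - b *\<^sub>R res y) \<le> F y"
proof -
  have "J y = y - res y" by (simp add: res_def)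
  then have "(norm (res y))\<^sup>2 \<le> gr y - gr (J y) + G y \<bullet> res y"
    using fb_step_inequality[OF y, of y] unfolding power2_norm_eq_inner
    by (simp add: inner_diff_left)
  then have "b * (norm (res y))\<^sup>2 \<le> b * (gr y - gr (J y) + G y \<bullet> res y)"
    using b by (intro mult_left_mono)
  moreover have "0 \<le> b * (norm (res y))\<^sup>2" using b by simp
  ultimately show ?thesis using acc unfolding armijo_def by (simp add: algebra_simps)
qed

text \<open>The term \<open>(b - b\<^sup>2) \<parallel>res y\<parallel>\<^sup>2\<close> left over is nonnegative; this is where \<open>b \<le> 1\<close>
  is needed.\<close>

lemma quasi_fejer:
  assumes y: "y \<in> edom g" and u: "u \<in> edom g" and b: "0 \<le> b" "b \<le> 1" and acc: "armijo y b"
  shows "(norm (y - b *\<^sub>R res y - u))\<^sup>2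
    \<le> (norm (y - u))\<^sup>2 + 2 * b * (F u - F y) + 2 * (F y - F (y - b *\<^sub>R res y))"
proof -
  let ?d = "res y" and ?n = "(norm (res y))\<^sup>2"
  have Jy: "u - J y = (u - y) + ?d" by (simp add: res_def)
  have "gr (J y) + ((?d - G y) \<bullet> (u - y) + (?d - G y) \<bullet> ?d) \<le> gr u"
    using fb_step_inequality[OF u, of y] unfolding Jy inner_add_right .
  moreover have "fr y + G y \<bullet> (u - y) \<le> fr u" by (rule f_gradient_inequality[OF y u])
  ultimately have "?n - (F u - F y) - (gr y - gr (J y) + G y \<bullet> ?d) \<le> - (?d \<bullet> (u - y))"
    unfolding F_def power2_norm_eq_inner by (simp add: inner_diff_left)
  then have key: "2 * b * (?n - (F u - F y) - (gr y - gr (J y) + G y \<bullet> ?d))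
      \<le> 2 * b * (- (?d \<bullet> (u - y)))"
    using b by (intro mult_left_mono) auto
  have "(norm (y - b *\<^sub>R ?d - u))\<^sup>2 = (norm (y - u))\<^sup>2 + 2 * b * (?d \<bullet> (u - y)) + b\<^sup>2 * ?n"
    unfolding power2_norm_eq_inner
    by (simp add: inner_diff inner_commute power2_eq_square algebra_simps)
  moreover have "b\<^sup>2 * ?n \<le> b * ?n"
    using b by (intro mult_right_mono) (auto simp: power2_eq_square mult_left_le)
  \<comment> \<open>The test bounds \<open>2 * b\<close> times the linearized decrease by twice the
    actual decrease of \<open>F\<close> plus \<open>b * ?n\<close>.\<close>
  ultimately show ?thesis using key acc unfolding armijo_def by (simp add: algebra_simps)
qed

lemma sum_lower_semicontinuous:
  assumes y: "y \<longlonglongrightarrow> u" "\<And>n. f (y n) + g (y n) \<le> ereal (a n)" and a: "a \<longlonglongrightarrow> l"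
  shows "f u + g u \<le> ereal l"
proof -
  have fu: "f u \<le> liminf (\<lambda>n. f (y n))" and gu: "g u \<le> liminf (\<lambda>n. g (y n))"
    using lsc_fun_liminf[OF f(2) y(1)] lsc_fun_liminf[OF g(2) y(1)] .
  \<comment> \<open>Properness keeps both lower limits above \<open>-\<infinity>\<close>, so their
    sum is not of the form \<infinity> - \<infinity> and superadditivity of \<open>liminf\<close>
    applies.\<close>
  have "f u \<noteq> -\<infinity>" "g u \<noteq> -\<infinity>" using f(1) g(1) unfolding proper_fun_def by auto
  with fu gu have "liminf (\<lambda>n. f (y n)) \<noteq> -\<infinity>" "liminf (\<lambda>n. g (y n)) \<noteq> -\<infinity>" by auto
  then have "liminf (\<lambda>n. f (y n)) + liminf (\<lambda>n. g (y n)) \<le> liminf (\<lambda>n. f (y n) + g (y n))"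
    by (intro ereal_liminf_add_mono) auto
  moreover have "\<dots> \<le> ereal l" by (rule liminf_le_limit_bound[OF y(2) a])
  ultimately show ?thesis using add_mono[OF fu gu] by (blast intro: order_trans)
qed

end

section \<open>The iteration\<close>

locale method2_iteration = composite_problem f g
  for f g :: "'a::{real_inner, complete_space} \<Rightarrow> ereal" +
  fixes \<theta> :: real and x :: "nat \<Rightarrow> 'a" and s :: 'a
  assumes iter: "method2 f g \<theta> x"
    and sol: "s \<in> minimizers (\<lambda>y. f y + g y)"
begin

abbreviation "\<beta> k \<equiv> linesearch2 f g (x k) \<theta>"

lemma \<theta>: "0 < \<theta>" "\<theta> < 1"
  using iter unfolding method2_def by auto

lemma x_Suc: "x (Suc k) = x k - \<beta> k *\<^sub>R res (x k)"
  using iter unfolding method2_def res_def by auto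

lemma x_edom: "x k \<in> edom g"
proof (induction k)
  case 0
  then show ?case using iter unfolding method2_def by auto
next
  case (Suc k)
  then show ?case
    unfolding x_Suc using linesearch2_output(1,2)[OF Suc \<theta>] by (intro step_edom) auto
qed

lemmas \<beta>_pos = linesearch2_output(1)[OF x_edom \<theta>]
  and \<beta>_le_1 = linesearch2_output(2)[OF x_edom \<theta>]
  and \<beta>_armijo = linesearch2_output(3)[OF x_edom \<theta>]
  and \<beta>_rejected = linesearch2_output(4)[OF x_edom \<theta>]

lemma minimizer_edom:
  assumes "u \<in> minimizers (\<lambda>y. f y + g y)"
  shows "u \<in> edom g" and "y \<in> edom g \<Longrightarrow> F u \<le> F y"
proof -
  have le: "f u + g u \<le> f y + g y" for y
    using assms unfolding minimizers_def by blast
  show u: "u \<in> edom g"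
    using le[of "x 0"] sum_eq_F[OF x_edom] by (auto intro: sum_le_ereal_in_edom)
  show "F u \<le> F y" if "y \<in> edom g"
    using le[of y] sum_eq_F[OF u] sum_eq_F[OF that] by simp
qed

lemmas s_edom = minimizer_edom(1)[OF sol]
  and F_s_le = minimizer_edom(2)[OF sol]

lemma minimizerI:
  assumes "f u + g u \<le> ereal (F s)"
  shows "u \<in> minimizers (\<lambda>y. f y + g y)"
proof -
  have "ereal (F s) \<le> f y + g y" for y
    using sol sum_eq_F[OF s_edom] unfolding minimizers_def by auto
  with assms show ?thesis unfolding minimizers_def by (blast intro: order_trans)
qed

lemma objective_gap: "real_of_ereal ((f (x k) + g (x k)) - (INF y. f y + g y)) = F (x k) - F s"
proof -
  have "(INF y. f y + g y) = f s + g s"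
    using sol unfolding minimizers_def by (intro antisym INF_lower INF_greatest) auto
  then show ?thesis using sum_eq_F[OF s_edom] sum_eq_F[OF x_edom] by simp
qed

lemma F_decseq: "decseq (\<lambda>k. F (x k))"
  unfolding decseq_Suc_iff x_Suc
  using armijo_descent[OF x_edom less_imp_le[OF \<beta>_pos] \<beta>_armijo] by blast

lemma quasi_fejer_step:
  assumes "u \<in> edom g"
  shows "(norm (x (Suc k) - u))\<^sup>2
    \<le> (norm (x k - u))\<^sup>2 + 2 * \<beta> k * (F u - F (x k)) + 2 * (F (x k) - F (x (Suc k)))"
  using quasi_fejer[OF x_edom assms less_imp_le[OF \<beta>_pos] \<beta>_le_1 \<beta>_armijo]
  unfolding x_Suc .

text \<open>In the sum of the inequalities for \<open>u = s\<close>, the squared distances and the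
  differences of \<open>F\<close> both telescope, and \<open>F s\<close> bounds \<open>F\<close>
  from below on the iterates.\<close>

lemma weighted_gap_summable: "summable (\<lambda>k. \<beta> k * (F (x k) - F s))"
proof (rule summableI_nonneg_bounded)
  show "0 \<le> \<beta> k * (F (x k) - F s)" for k
    using \<beta>_pos F_s_le[OF x_edom] by (simp add: less_imp_le)
  fix n
  have "2 * (\<Sum>k<n. \<beta> k * (F (x k) - F s))
      \<le> (norm (x 0 - s))\<^sup>2 - (norm (x n - s))\<^sup>2 + 2 * (F (x 0) - F (x n))"
  proof (induction n)
    case (Suc n)
    then show ?case using quasi_fejer_step[OF s_edom, of n] by (simp add: algebra_simps)
  qed simp
  moreover have "0 \<le> (norm (x n - s))\<^sup>2" "F s \<le> F (x n)" using F_s_le[OF x_edom] by auto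
  ultimately show "(\<Sum>k<n. \<beta> k * (F (x k) - F s)) \<le> (norm (x 0 - s))\<^sup>2 / 2 + (F (x 0) - F s)"
    by argo
qed

lemma gap_smallo:
  assumes c: "c > 0" and ev: "eventually (\<lambda>k. c \<le> \<beta> k) sequentially"
  shows "(\<lambda>k. F (x k) - F s) \<in> o(\<lambda>k. 1 / real k)"
proof (rule decseq_summable_smallo)
  show "decseq (\<lambda>k. F (x k) - F s)" using F_decseq by (simp add: decseq_def)
  show nonneg: "0 \<le> F (x k) - F s" for k using F_s_le[OF x_edom] by simp
  show "summable (\<lambda>k. F (x k) - F s)"
  proof (rule summable_comparison_test_ev)
    show "summable (\<lambda>k. (1 / c) * (\<beta> k * (F (x k) - F s)))"
      by (intro summable_mult weighted_gap_summable)
    show "\<forall>\<^sub>F k in sequentially. norm (F (x k) - F s) \<le> (1 / c) * (\<beta> k * (F (x k) - F s))"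
      using ev
    proof eventually_elim
      case (elim k)
      then have "c * (F (x k) - F s) \<le> \<beta> k * (F (x k) - F s)"
        using nonneg by (intro mult_right_mono)
      then show ?case using c nonneg[of k] by (simp add: field_simps)
    qed
  qed
qed

lemma gradient_gap:
  assumes "\<beta> k \<noteq> 1"
  shows "x k - (\<beta> k / \<theta>) *\<^sub>R res (x k) \<in> edom g"
    and "norm (res (x k)) / 2 < norm (G (x k) - G (x k - (\<beta> k / \<theta>) *\<^sub>R res (x k)))"
proof -
  have b: "0 < \<beta> k / \<theta>" "\<beta> k / \<theta> \<le> 1" "\<not> armijo (x k) (\<beta> k / \<theta>)"
    using \<beta>_rejected[of k] assms \<beta>_pos[of k] \<theta> by auto
  show "x k - (\<beta> k / \<theta>) *\<^sub>R res (x k) \<in> edom g"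
    using b by (intro step_edom x_edom) auto
  show "norm (res (x k)) / 2 < norm (G (x k) - G (x k - (\<beta> k / \<theta>) *\<^sub>R res (x k)))"
    using not_armijo_gradient_gap[OF x_edom b] .
qed

text \<open>The residual is nonzero because the gradient gap is strict, so it cancels from both
  sides and leaves \<open>1 / 2 < L * (\<beta> k / \<theta>)\<close>. \<open>S\<close> is left
  general: it is \<open>edom g\<close> in the global case and a ball in the local one.\<close>

lemma stepsize_lower_bound:
  assumes lip: "L-lipschitz_on S G" and L: "L > 0"
    and S: "x k \<in> S" "\<beta> k \<noteq> 1 \<Longrightarrow> x k - (\<beta> k / \<theta>) *\<^sub>R res (x k) \<in> S"
  shows "min 1 (\<theta> / (2 * L)) \<le> \<beta> k"
proof (cases "\<beta> k = 1")
  case False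
  let ?d = "res (x k)"
  have "norm ?d / 2 < norm (G (x k) - G (x k - (\<beta> k / \<theta>) *\<^sub>R ?d))"
    by (rule gradient_gap(2)[OF False])
  also have "\<dots> \<le> L * norm ((\<beta> k / \<theta>) *\<^sub>R ?d)"
    using lipschitz_onD[OF lip S(1) S(2)[OF False]] by (simp add: dist_norm)
  also have "\<dots> = (L * (\<beta> k / \<theta>)) * norm ?d"
    using \<beta>_pos[of k] \<theta> by simp
  finally have *: "(1 / 2) * norm ?d < (L * (\<beta> k / \<theta>)) * norm ?d" by simp
  then have "norm ?d > 0" by (cases "res (x k) = 0") auto
  with * have "1 / 2 < L * (\<beta> k / \<theta>)" by (simp only: mult_less_cancel_right_pos)
  then have "\<theta> / (2 * L) < \<beta> k" using \<theta> L by (simp add: field_simps)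
  then show ?thesis by simp
qed simp

lemma gap_smallo_global_lipschitz:
  assumes "L-lipschitz_on (edom g) G"
  shows "(\<lambda>k. F (x k) - F s) \<in> o(\<lambda>k. 1 / real k)"
proof (rule gap_smallo)
  \<comment> \<open>A Lipschitz constant may be 0, and the stepsize bound divides by it.\<close>
  have lip: "(max L 1)-lipschitz_on (edom g) G"
    by (rule lipschitz_on_le[OF assms]) simp
  show "0 < min 1 (\<theta> / (2 * max L 1))" using \<theta> by auto
  show "\<forall>\<^sub>F k in sequentially. min 1 (\<theta> / (2 * max L 1)) \<le> \<beta> k"
    using stepsize_lower_bound[OF lip _ x_edom gradient_gap(1)] by auto
qed

text \<open>Adding \<open>2 * F (x k)\<close> to the squared distance from \<open>s\<close> absorbs
  the objective difference in the inequality for \<open>u = s\<close>, so the combined quantity is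
  nonincreasing.\<close>

lemma x_bounded: "bounded (range x)"
proof -
  have le: "(norm (x k - s))\<^sup>2 + 2 * F (x k) \<le> (norm (x 0 - s))\<^sup>2 + 2 * F (x 0)" for k
  proof (induction k)
    case (Suc k)
    have "\<beta> k * (F s - F (x k)) \<le> 0"
      using \<beta>_pos[of k] F_s_le[OF x_edom, of k] by (simp add: mult_le_0_iff)
    then show ?case using Suc quasi_fejer_step[OF s_edom, of k] by argo
  qed simp
  define C where "C = (norm (x 0 - s))\<^sup>2 + 2 * (F (x 0) - F s)"
  have "norm (x k) \<le> norm s + sqrt C" for k
  proof -
    have "(norm (x k - s))\<^sup>2 \<le> C"
      using le[of k] F_s_le[OF x_edom, of k] unfolding C_def by argo
    then have "norm (x k - s) \<le> sqrt C" by (rule real_le_rsqrt)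
    then show ?thesis using norm_triangle_ineq[of s "x k - s"] by simp
  qed
  then show ?thesis by (auto simp: bounded_iff)
qed

text \<open>For a minimizer the sequence \<open>\<parallel>x k - u\<parallel>\<^sup>2 + 2 F (x k)\<close> is decreasing, so a cluster point that
  is a minimizer is the limit.\<close>

lemma minimizer_cluster_point_limit:
  assumes u: "u \<in> minimizers (\<lambda>y. f y + g y)"
    and r: "strict_mono r" "(\<lambda>n. x (r n)) \<longlonglongrightarrow> u"
  shows "x \<longlonglongrightarrow> u"
proof -
  define V where "V k = (norm (x k - u))\<^sup>2 + 2 * F (x k)" for k
  have "decseq V"
    unfolding decseq_Suc_iff
  proof
    fix k
    have "\<beta> k * (F u - F (x k)) \<le> 0"
      using \<beta>_pos[of k] minimizer_edom(2)[OF u x_edom, of k] by (simp add: mult_le_0_iff)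
    then show "V (Suc k) \<le> V k"
      using quasi_fejer_step[OF minimizer_edom(1)[OF u], of k] unfolding V_def by argo
  qed
  moreover have "2 * F s \<le> V k" for k
    using F_s_le[OF x_edom, of k] zero_le_power2[of "norm (x k - u)"] unfolding V_def by linarith
  ultimately obtain v where v: "V \<longlonglongrightarrow> v" using decseq_convergent by blast
  obtain l where l: "(\<lambda>k. F (x k)) \<longlonglongrightarrow> l"
    using decseq_convergent[OF F_decseq] F_s_le[OF x_edom] by blast
  \<comment> \<open>\<open>F (x k)\<close> has a limit of its own, so the squared distances
    converge; the subsequence then identifies their limit as 0.\<close>
  have lim: "(\<lambda>k. (norm (x k - u))\<^sup>2) \<longlonglongrightarrow> v - 2 * l"
    using tendsto_diff[OF v tendsto_mult[OF tendsto_const[of 2] l]] by (simp add: V_def)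
  then have "(\<lambda>n. (norm (x (r n) - u))\<^sup>2) \<longlonglongrightarrow> v - 2 * l"
    using LIMSEQ_subseq_LIMSEQ[OF lim r(1)] by (simp add: o_def)
  moreover have "(\<lambda>n. (norm (x (r n) - u))\<^sup>2) \<longlonglongrightarrow> (norm (u - u))\<^sup>2"
    using r(2) by (intro tendsto_intros)
  ultimately have "v - 2 * l = 0" using LIMSEQ_unique by fastforce
  with lim have "(\<lambda>k. sqrt ((norm (x k - u))\<^sup>2)) \<longlonglongrightarrow> sqrt 0"
    by (intro tendsto_real_sqrt) simp
  then have "(\<lambda>k. norm (x k - u)) \<longlonglongrightarrow> 0" by simp
  then show ?thesis using LIM_zero_cancel tendsto_norm_zero_iff by blast
qed

end

section \<open>Optimality of cluster points and the local rate\<close>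

locale method2_bounded_gradient = method2_iteration +
  assumes grad_ucont: "\<And>B. B \<subseteq> edom g \<Longrightarrow> bounded B \<Longrightarrow> uniformly_continuous_on B (grad f)"
    and grad_bdd: "\<And>B. B \<subseteq> edom g \<Longrightarrow> bounded B \<Longrightarrow> bounded (grad f ` B)"
begin

text \<open>Nonexpansiveness compares \<open>J (x k)\<close> with the proximal point of 0, and
  boundedness of the gradient on the iterates controls the argument
  \<open>x k - G (x k)\<close>.\<close>

lemma J_bounded: "bounded (range (\<lambda>k. J (x k)))"
proof -
  obtain a where a: "\<And>k. norm (x k) \<le> a" using x_bounded by (auto simp: bounded_iff)
  have "bounded (G ` range x)" using x_edom x_bounded by (intro grad_bdd) auto
  then obtain b where b: "\<And>k. norm (G (x k)) \<le> b" by (auto simp: bounded_iff)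
  let ?q = "prox g 0"
  have "norm (J (x k)) \<le> norm ?q + a + b" for k
  proof -
    have "norm (J (x k) - ?q) \<le> norm ((x k - G (x k)) - 0)"
      unfolding fb_step_def by (intro resolvent_nonexpansive[OF g(1)] prox_subdifferential[OF g])
    also have "\<dots> \<le> a + b" using norm_triangle_ineq4[of "x k" "G (x k)"] a[of k] b[of k] by simp
    finally show ?thesis using norm_triangle_ineq[of ?q "J (x k) - ?q"] by simp
  qed
  then show ?thesis by (auto simp: bounded_iff)
qed

lemma res_bounded: obtains D where "D > 0" "\<And>k. norm (res (x k)) \<le> D"
proof -
  obtain a b where ab: "\<And>k. norm (x k) \<le> a" "\<And>k. norm (J (x k)) \<le> b"
    using x_bounded J_bounded by (auto simp: bounded_iff)
  have "norm (res (x k)) \<le> a + b" for k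
    using norm_triangle_ineq4[of "x k" "J (x k)"] ab[of k] unfolding res_def by linarith
  then show ?thesis using that[of "max 1 (a + b)"] by (auto simp: le_max_iff_disj)
qed

lemma gradient_difference_tendsto_0:
  assumes "\<And>k. y k \<in> edom g" "bounded (range y)" "(\<lambda>k. y k - x k) \<longlonglongrightarrow> 0"
  shows "(\<lambda>k. G (y k) - G (x k)) \<longlonglongrightarrow> 0"
proof -
  let ?B = "range x \<union> range y"
  have "uniformly_continuous_on ?B G"
    using assms(1,2) x_edom x_bounded by (intro grad_ucont) auto
  moreover have "(\<lambda>k. dist (y k) (x k)) \<longlonglongrightarrow> 0"
    using tendsto_norm_zero[OF assms(3)] by (simp add: dist_norm)
  ultimately have "(\<lambda>k. dist (G (y k)) (G (x k))) \<longlonglongrightarrow> 0"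
    unfolding uniformly_continuous_on_sequentially by blast
  then show ?thesis unfolding dist_norm tendsto_norm_zero_iff .
qed

lemma residual_tendsto_0:
  assumes \<beta>0: "\<beta> \<longlonglongrightarrow> 0"
  shows "(\<lambda>k. res (x k)) \<longlonglongrightarrow> 0"
proof -
  obtain D where D: "D > 0" "\<And>k. norm (res (x k)) \<le> D" using res_bounded by blast
  obtain a where a: "\<And>k. norm (x k) \<le> a" using x_bounded by (auto simp: bounded_iff)
  \<comment> \<open>This is the last rejected trial point. Where the first trial was accepted,
    \<open>x k\<close> fills in, so that \<open>y k\<close> always lies in
    \<open>edom g\<close>.\<close>
  define y where "y k = (if \<beta> k = 1 then x k else x k - (\<beta> k / \<theta>) *\<^sub>R res (x k))" for k
  have y_edom: "y k \<in> edom g" for k unfolding y_def using x_edom gradient_gap(1) by auto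
  have dist_y: "norm (y k - x k) \<le> (\<beta> k / \<theta>) * D" for k
  proof -
    have "norm (y k - x k) \<le> (\<beta> k / \<theta>) * norm (res (x k))"
      unfolding y_def using \<beta>_pos[of k] \<theta> by auto
    also have "\<dots> \<le> (\<beta> k / \<theta>) * D" using D(2) \<beta>_pos[of k] \<theta> by (intro mult_left_mono) auto
    finally show ?thesis .
  qed
  have "norm (y k) \<le> a + D / \<theta>" for k
  proof -
    have "(\<beta> k / \<theta>) * D \<le> (1 / \<theta>) * D"
      using \<beta>_le_1[of k] D(1) \<theta> by (intro mult_right_mono divide_right_mono) auto
    then show ?thesis
      using dist_y[of k] a[of k] norm_triangle_ineq[of "x k" "y k - x k"] by simp
  qed
  then have "bounded (range y)" by (auto simp: bounded_iff)
  moreover have "(\<lambda>k. y k - x k) \<longlonglongrightarrow> 0"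
  proof (rule Lim_null_comparison)
    show "\<forall>\<^sub>F k in sequentially. norm (y k - x k) \<le> (\<beta> k / \<theta>) * D" using dist_y by simp
    show "(\<lambda>k. (\<beta> k / \<theta>) * D) \<longlonglongrightarrow> 0" using \<beta>0 \<theta> by (auto intro!: tendsto_eq_intros)
  qed
  ultimately have Gy: "(\<lambda>k. G (y k) - G (x k)) \<longlonglongrightarrow> 0"
    using y_edom by (intro gradient_difference_tendsto_0)
  show ?thesis
  proof (rule Lim_null_comparison)
    show "(\<lambda>k. 2 * norm (G (y k) - G (x k))) \<longlonglongrightarrow> 0"
      using tendsto_mult[OF tendsto_const[of 2] tendsto_norm_zero[OF Gy]] by simp
    have "\<forall>\<^sub>F k in sequentially. \<beta> k < 1" using \<beta>0 by (rule order_tendstoD) simp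
    then show "\<forall>\<^sub>F k in sequentially. norm (res (x k)) \<le> 2 * norm (G (y k) - G (x k))"
    proof eventually_elim
      case (elim k)
      then show ?case using gradient_gap(2)[of k] unfolding y_def by (simp add: norm_minus_commute)
    qed
  qed
qed

text \<open>The vector \<open>res (x k) + (G (J (x k)) - G (x k))\<close> acts as a subgradient of
  the sum at \<open>J (x k)\<close> and tends to 0. As the \<open>J (x k)\<close> are bounded, their
  values exceed \<open>F s\<close> by at most a null sequence, and lower semicontinuity passes this
  on to \<open>u\<close>, the limit of \<open>J (x (r n))\<close>.\<close>

lemma cluster_point_minimizer_if_residual_tendsto_0:
  assumes res0: "(\<lambda>k. res (x k)) \<longlonglongrightarrow> 0"
    and r: "strict_mono r" "(\<lambda>n. x (r n)) \<longlonglongrightarrow> u"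
  shows "u \<in> minimizers (\<lambda>y. f y + g y)"
proof -
  have Jx: "(\<lambda>k. J (x k) - x k) \<longlonglongrightarrow> 0"
    using tendsto_minus[OF res0] by (simp add: res_def)
  have GJ: "(\<lambda>k. G (J (x k)) - G (x k)) \<longlonglongrightarrow> 0"
    using J_edom J_bounded Jx by (intro gradient_difference_tendsto_0)
  obtain b where b: "\<And>k. norm (J (x k)) \<le> b" using J_bounded by (auto simp: bounded_iff)
  define e where "e k = norm (res (x k) + (G (J (x k)) - G (x k))) * (norm s + b)" for k
  have "(\<lambda>k. norm (res (x k) + (G (J (x k)) - G (x k))) * (norm s + b))
      \<longlonglongrightarrow> norm ((0::'a) + 0) * (norm s + b)"
    by (intro tendsto_intros res0 GJ)
  then have e0: "e \<longlonglongrightarrow> 0" by (simp add: e_def[abs_def])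
  have F_J: "F (J (x k)) \<le> F s + e k" for k
  proof -
    let ?w = "res (x k) + (G (J (x k)) - G (x k))"
    have "fr (J (x k)) + G (J (x k)) \<bullet> (s - J (x k)) \<le> fr s"
      by (rule f_gradient_inequality[OF J_edom s_edom])
    moreover have "gr (J (x k)) + (res (x k) - G (x k)) \<bullet> (s - J (x k)) \<le> gr s"
      by (rule fb_step_inequality[OF s_edom])
    ultimately have "F (J (x k)) \<le> F s + ?w \<bullet> (J (x k) - s)"
      unfolding F_def by (simp add: inner_diff inner_add)
    also have "?w \<bullet> (J (x k) - s) \<le> norm ?w * norm (J (x k) - s)" by (rule norm_cauchy_schwarz)
    also have "\<dots> \<le> e k"
      unfolding e_def using norm_triangle_ineq4[of "J (x k)" s] b[of k]
      by (intro mult_left_mono) auto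
    finally show ?thesis by simp
  qed
  have "(\<lambda>n. J (x (r n)) - x (r n)) \<longlonglongrightarrow> 0"
    using LIMSEQ_subseq_LIMSEQ[OF Jx r(1)] by (simp add: o_def)
  from tendsto_add[OF r(2) this] have "(\<lambda>n. J (x (r n))) \<longlonglongrightarrow> u" by simp
  moreover have "f (J (x (r n))) + g (J (x (r n))) \<le> ereal (F s + e (r n))" for n
    using F_J sum_eq_F[OF J_edom] by simp
  moreover have "(\<lambda>n. F s + e (r n)) \<longlonglongrightarrow> F s + 0"
    using LIMSEQ_subseq_LIMSEQ[OF e0 r(1)] by (intro tendsto_intros) (simp add: o_def)
  ultimately have "f u + g u \<le> ereal (F s + 0)" by (rule sum_lower_semicontinuous)
  then show ?thesis by (intro minimizerI) simp
qed

lemma cluster_point_minimizer: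
  assumes r: "strict_mono r" "(\<lambda>n. x (r n)) \<longlonglongrightarrow> u"
  shows "u \<in> minimizers (\<lambda>y. f y + g y)"
proof -
  obtain l where l: "(\<lambda>k. F (x k)) \<longlonglongrightarrow> l" "\<And>k. l \<le> F (x k)"
    using decseq_convergent[OF F_decseq] F_s_le[OF x_edom] by metis
  have "F s \<le> l" using l(1) F_s_le[OF x_edom] by (intro LIMSEQ_le_const) auto
  then consider "l = F s" | "F s < l" by linarith
  then show ?thesis
  proof cases
    case 1
    have "f (x (r n)) + g (x (r n)) \<le> ereal (F (x (r n)))" for n
      using sum_eq_F[OF x_edom] by simp
    moreover have "(\<lambda>n. F (x (r n))) \<longlonglongrightarrow> l"
      using LIMSEQ_subseq_LIMSEQ[OF l(1) r(1)] by (simp add: o_def)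
    ultimately have "f u + g u \<le> ereal l" by (rule sum_lower_semicontinuous[OF r(2)])
    then show ?thesis using 1 by (intro minimizerI) simp
  next
    case 2
    \<comment> \<open>The gaps are at least \<open>l - F s > 0\<close> here, so summability of the
      weighted gaps passes to the weights.\<close>
    have "summable \<beta>"
    proof (rule summable_comparison_test')
      show "summable (\<lambda>k. (1 / (l - F s)) * (\<beta> k * (F (x k) - F s)))"
        by (intro summable_mult weighted_gap_summable)
      fix k
      have "\<beta> k * (l - F s) \<le> \<beta> k * (F (x k) - F s)"
        using l(2)[of k] \<beta>_pos[of k] by (intro mult_left_mono) auto
      then show "norm (\<beta> k) \<le> (1 / (l - F s)) * (\<beta> k * (F (x k) - F s))"
        using 2 \<beta>_pos[of k] by (simp add: field_simps)
    qed
    then have "\<beta> \<longlonglongrightarrow> 0" by (rule summable_LIMSEQ_zero)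
    then show ?thesis
      by (intro cluster_point_minimizer_if_residual_tendsto_0[OF residual_tendsto_0 r])
  qed
qed

lemma gap_smallo_local_lipschitz:
  assumes u: "x \<longlonglongrightarrow> u" and e: "\<epsilon> > 0" and L: "L > 0" "L-lipschitz_on (cball u \<epsilon>) G"
  shows "(\<lambda>k. F (x k) - F s) \<in> o(\<lambda>k. 1 / real k)"
proof -
  obtain D where D: "D > 0" "\<And>k. norm (res (x k)) \<le> D" using res_bounded by blast
  \<comment> \<open>A stepsize below the first entry puts the last rejected trial within
    \<open>\<epsilon> / 2\<close> of \<open>x k\<close>, hence in the ball once \<open>x k\<close>
    is within \<open>\<epsilon> / 2\<close> of \<open>u\<close>. The remaining entry is then the
    Lipschitz bound.\<close>
  define c where "c = min (\<theta> * \<epsilon> / (2 * D)) (min 1 (\<theta> / (2 * L)))"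
  have "\<forall>\<^sub>F k in sequentially. dist (x k) u < \<epsilon> / 2"
    using u e by (intro tendstoD) auto
  then have "\<forall>\<^sub>F k in sequentially. c \<le> \<beta> k"
  proof eventually_elim
    case (elim k)
    show ?case
    proof (cases "\<theta> * \<epsilon> / (2 * D) \<le> \<beta> k")
      case True
      then show ?thesis by (simp add: c_def min.coboundedI1)
    next
      case False
      have "norm ((\<beta> k / \<theta>) *\<^sub>R res (x k)) \<le> (\<beta> k / \<theta>) * D"
        using \<beta>_pos[of k] \<theta> D by (simp add: mult_left_mono divide_right_mono)
      also have "\<dots> \<le> \<epsilon> / 2" using False \<theta> D by (simp add: field_simps)
      finally have "dist (x k) (x k - (\<beta> k / \<theta>) *\<^sub>R res (x k)) \<le> \<epsilon> / 2" by (simp add: dist_norm)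
      then have "x k - (\<beta> k / \<theta>) *\<^sub>R res (x k) \<in> cball u \<epsilon>"
        using elim dist_triangle[of u "x k - (\<beta> k / \<theta>) *\<^sub>R res (x k)" "x k"]
        unfolding mem_cball dist_commute[of "x k" u] by linarith
      moreover have "x k \<in> cball u \<epsilon>" using elim e by (simp add: dist_commute)
      ultimately have "min 1 (\<theta> / (2 * L)) \<le> \<beta> k" by (intro stepsize_lower_bound[OF L(2,1)])
      then show ?thesis by (simp add: c_def min.coboundedI2)
    qed
  qed
  moreover have "c > 0" using \<theta> e D L by (simp add: c_def)
  ultimately show ?thesis by (intro gap_smallo)
qed

end

theorem corollary5p5:
  fixes f g :: "'a::{real_inner, complete_space} \<Rightarrow> ereal"
    and \<theta> :: real
    and x :: "nat \<Rightarrow> 'a"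
  assumes f: "proper_fun f" "lsc_fun f" "convex_fun f"
    and g: "proper_fun g" "lsc_fun g" "convex_fun g"
    and dom: "edom g \<subseteq> edom f"
    and diff: "\<exists>U. open U \<and> edom g \<subseteq> U \<and> frechet_differentiable_on f U"
    and grad_ucont: "\<And>B. B \<subseteq> edom g \<Longrightarrow> bounded B \<Longrightarrow> uniformly_continuous_on B (grad f)"
    and grad_bdd: "\<And>B. B \<subseteq> edom g \<Longrightarrow> bounded B \<Longrightarrow> bounded (grad f ` B)"
    and iter: "method2 f g \<theta> x"
    and sol: "minimizers (\<lambda>y. f y + g y) \<noteq> {}"
  shows
    "((\<exists>L. L-lipschitz_on (edom g) (grad f)) \<longrightarrow>
        (\<lambda>k. real_of_ereal ((f (x k) + g (x k)) - (INF y. f y + g y))) \<in> O(\<lambda>k. 1 / real k))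
     \<and>
     ((\<exists>B::'a set. finite B \<and> span B = UNIV) \<and>
      locally_lipschitz_at_points (minimizers (\<lambda>y. f y + g y)) (grad f) \<longrightarrow>
        (\<lambda>k. real_of_ereal ((f (x k) + g (x k)) - (INF y. f y + g y))) \<in> o(\<lambda>k. 1 / real k))"
proof -
  obtain s where s: "s \<in> minimizers (\<lambda>y. f y + g y)" using sol by blast
  interpret method2_bounded_gradient f g \<theta> x s
  proof
    show "(\<lambda>y. real_of_ereal (f y)) differentiable at y" if "y \<in> edom g" for y
      using diff that unfolding frechet_differentiable_on_def by blast
  qed (fact f g dom iter s grad_ucont grad_bdd)+
  show ?thesis
    unfolding objective_gap
  proof (intro conjI impI)
    assume "\<exists>L. L-lipschitz_on (edom g) (grad f)"
    then show "(\<lambda>k. F (x k) - F s) \<in> O(\<lambda>k. 1 / real k)"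
      \<comment> \<open>The global case has the little-o rate as well, weakened here to
        big-O.\<close>
      using gap_smallo_global_lipschitz landau_o.small_imp_big by blast
  next
    assume "(\<exists>B::'a set. finite B \<and> span B = UNIV) \<and>
      locally_lipschitz_at_points (minimizers (\<lambda>y. f y + g y)) (grad f)"
    then obtain B :: "'a set" where B: "finite B" "span B = UNIV"
      and lip: "locally_lipschitz_at_points (minimizers (\<lambda>y. f y + g y)) (grad f)" by blast
    \<comment> \<open>Finite dimension enters here, supplying a cluster point of the bounded
      iterates.\<close>
    obtain u r where r: "strict_mono r" "(\<lambda>n. x (r n)) \<longlonglongrightarrow> u"
      using finite_span_convergent_subsequence[OF B x_bounded] .
    have u: "u \<in> minimizers (\<lambda>y. f y + g y)" by (rule cluster_point_minimizer[OF r])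
    obtain \<epsilon> L where "\<epsilon> > 0" "L > 0" "L-lipschitz_on (cball u \<epsilon>) (grad f)"
      using lip u unfolding locally_lipschitz_at_points_def by blast
    then show "(\<lambda>k. F (x k) - F s) \<in> o(\<lambda>k. 1 / real k)"
      by (intro gap_smallo_local_lipschitz[OF minimizer_cluster_point_limit[OF u r]])
  qed
qed

end
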